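(* Let $G$ and $G'$ be finite abelian groups. Then $G$ and $G'$ are isomorphic as groups if and only if the order canonical $\mathcal{E}$-lattice associated to $G$ and the order canonical $\mathcal{E}$-lattice associated to $G'$ are isomorphic as $\mathcal{E}$-lattices.
   Context: **$\mathcal{E}$-lattices.** Let $L$ be a nonempty set and $\varepsilon: L\to L$ a map. $L$ is an $\mathcal{E}$-lattice (relative to $\varepsilon$) if there are two binary operations $\wedge_\varepsilon,\vee_\varepsilon$ on $L$ such that for all $a,b,c\in L$: (a) $a\wedge_\varepsilon(b\wedge_\varepsilon c)=(a\wedge_\varepsilon b)\wedge_\varepsilon c$ and $a\vee_\varepsilon(b\vee_\varepsilon c)=(a\vee_\varepsilon b)\vee_\varepsilon c$; (b) $a\wedge_\varepsilon b=b\wedge_\varepsilon a$ and $a\vee_\varepsilon b=b\vee_\varepsilon a$; (c) $a\wedge_\varepsilon a=a\vee_\varepsilon a=\varepsilon(a)$; (d) $a\wedge_\varepsilon(a\vee_\varepsilon b)=a\vee_\varepsilon(a\wedge_\varepsilon b)=\varepsilon(a)$. Write $\mathrm{Fix}\,\varepsilon=\{a\in L\mid \varepsilon(a)=a\}$. The $\mathcal{E}$-lattice is called canonical if $a\wedge_\varepsilon b,\ a\vee_\varepsilon b\in\mathrm{Fix}\,\varepsilon$ for all $a,b\in L$. **Isomorphisms.** If $(L_1,\wedge_{\varepsilon_1},\vee_{\varepsilon_1})$ and $(L_2,\wedge_{\varepsilon_2},\vee_{\varepsilon_2})$ are $\mathcal{E}$-lattices relative to $\varepsilon_1,\varepsilon_2$,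 a map $f:L_1\to L_2$ is an $\mathcal{E}$-lattice homomorphism if $f\circ\varepsilon_1=\varepsilon_2\circ f$ and, for all $a,b\in L_1$, $f(a\wedge_{\varepsilon_1}b)=f(a)\wedge_{\varepsilon_2}f(b)$ and $f(a\vee_{\varepsilon_1}b)=f(a)\vee_{\varepsilon_2}f(b)$. It is an $\mathcal{E}$-lattice isomorphism if moreover it is bijective. Two $\mathcal{E}$-lattices are isomorphic if there is an $\mathcal{E}$-lattice isomorphism between them. **The order canonical $\mathcal{E}$-lattice of a finite abelian group $G$.** Let $n=|G|$ and let $L_n$ be the lattice of all (positive) divisors of $n$ under divisibility (meet is gcd, join is lcm). Define on $G$ the equivalence relation $a\sim a'$ iff $\mathrm{ord}(a)=\mathrm{ord}(a')$, and fix a set of representatives $\{a_i\mid i\in I\}$ for the equivalence classes modulo $\sim$. Since $G$ is finite abelian, $\{\mathrm{ord}(a_i)\mid i\in I\}$ is a sublattice of $L_n$; transporting its structure along the bijection $a_i\mapsto\mathrm{ord}(a_i)$ gives a lattice $(\{a_i\mid i\in I\},\wedge,\vee)$, i.e. $a_i\wedge a_j$ (resp. $a_i\vee a_j$) is the representative whose order is $\gcd(\mathrm{ord}(a_i),\mathrm{ord}(a_j))$ (resp. $\mathrm{lcm}(\mathrm{ord}(a_i),\mathrm{ord}(a_j))$). Let $\varepsilon:G\to G$ send each $a\in G$ to the unique representative $a_i$ with $\mathrm{ord}(a_i)=\mathrm{ord}(a)$, and put $a\wedge_\varepsilon b=\varepsilon(a)\wedge\varepsilon(b)$, $a\vee_\varepsilon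 b=\varepsilon(a)\vee\varepsilon(b)$ for $a,b\in G$. Then $G$ with $\varepsilon,\wedge_\varepsilon,\vee_\varepsilon$ is a canonical $\mathcal{E}$-lattice, called the order canonical $\mathcal{E}$-lattice associated to $G$. The sets of representatives for $G$ and $G'$ are arbitrary fixed choices. *)

theory Defs
  imports "HOL-Algebra.Algebra"
begin

record 'a e_struct = "'a partial_object" +
  eps :: "'a \<Rightarrow> 'a"  (\<open>\<epsilon>\<index>\<close>)
  emeet :: "'a \<Rightarrow> 'a \<Rightarrow> 'a"  (infixl \<open>\<sqinter>\<^sub>\<epsilon>\<index>\<close> 70)
  ejoin :: "'a \<Rightarrow> 'a \<Rightarrow> 'a"  (infixl \<open>\<squnion>\<^sub>\<epsilon>\<index>\<close> 65)

locale e_lattice =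
  fixes L (structure)
  assumes carrier_nonempty: "carrier L \<noteq> {}"
    and eps_closed: "a \<in> carrier L \<Longrightarrow> \<epsilon> a \<in> carrier L"
    and meet_closed: "\<lbrakk>a \<in> carrier L; b \<in> carrier L\<rbrakk> \<Longrightarrow> a \<sqinter>\<^sub>\<epsilon> b \<in> carrier L"
    and join_closed: "\<lbrakk>a \<in> carrier L; b \<in> carrier L\<rbrakk> \<Longrightarrow> a \<squnion>\<^sub>\<epsilon> b \<in> carrier L"
    and meet_assoc: "\<lbrakk>a \<in> carrier L; b \<in> carrier L; c \<in> carrier L\<rbrakk>
      \<Longrightarrow> a \<sqinter>\<^sub>\<epsilon> (b \<sqinter>\<^sub>\<epsilon> c) = (a \<sqinter>\<^sub>\<epsilon> b) \<sqinter>\<^sub>\<epsilon> c"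
    and join_assoc: "\<lbrakk>a \<in> carrier L; b \<in> carrier L; c \<in> carrier L\<rbrakk>
      \<Longrightarrow> a \<squnion>\<^sub>\<epsilon> (b \<squnion>\<^sub>\<epsilon> c) = (a \<squnion>\<^sub>\<epsilon> b) \<squnion>\<^sub>\<epsilon> c"
    and meet_comm: "\<lbrakk>a \<in> carrier L; b \<in> carrier L\<rbrakk> \<Longrightarrow> a \<sqinter>\<^sub>\<epsilon> b = b \<sqinter>\<^sub>\<epsilon> a"
    and join_comm: "\<lbrakk>a \<in> carrier L; b \<in> carrier L\<rbrakk> \<Longrightarrow> a \<squnion>\<^sub>\<epsilon> b = b \<squnion>\<^sub>\<epsilon> a"
    and meet_self: "a \<in> carrier L \<Longrightarrow> a \<sqinter>\<^sub>\<epsilon> a = \<epsilon> a"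
    and join_self: "a \<in> carrier L \<Longrightarrow> a \<squnion>\<^sub>\<epsilon> a = \<epsilon> a"
    and meet_absorb: "\<lbrakk>a \<in> carrier L; b \<in> carrier L\<rbrakk> \<Longrightarrow> a \<sqinter>\<^sub>\<epsilon> (a \<squnion>\<^sub>\<epsilon> b) = \<epsilon> a"
    and join_absorb: "\<lbrakk>a \<in> carrier L; b \<in> carrier L\<rbrakk> \<Longrightarrow> a \<squnion>\<^sub>\<epsilon> (a \<sqinter>\<^sub>\<epsilon> b) = \<epsilon> a"

definition e_Fix :: "('a, 'm) e_struct_scheme \<Rightarrow> 'a set" where
  "e_Fix L = {a \<in> carrier L. eps L a = a}"

locale canonical_e_lattice = e_lattice +
  assumes meet_Fix: "\<lbrakk>a \<in> carrier L; b \<in> carrier L\<rbrakk> \<Longrightarrow> a \<sqinter>\<^sub>\<epsilon> b \<in> e_Fix L"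
    and join_Fix: "\<lbrakk>a \<in> carrier L; b \<in> carrier L\<rbrakk> \<Longrightarrow> a \<squnion>\<^sub>\<epsilon> b \<in> e_Fix L"

definition e_hom :: "('a, 'm) e_struct_scheme \<Rightarrow> ('b, 'n) e_struct_scheme \<Rightarrow> ('a \<Rightarrow> 'b) set" where
  "e_hom L M = {f \<in> carrier L \<rightarrow> carrier M.
     (\<forall>a \<in> carrier L. f (eps L a) = eps M (f a)) \<and>
     (\<forall>a \<in> carrier L. \<forall>b \<in> carrier L.
        f (emeet L a b) = emeet M (f a) (f b) \<and> f (ejoin L a b) = ejoin M (f a) (f b))}"

definition e_iso :: "('a, 'm) e_struct_scheme \<Rightarrow> ('b, 'n) e_struct_scheme \<Rightarrow> ('a \<Rightarrow> 'b) set" where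
  "e_iso L M = {f \<in> e_hom L M. bij_betw f (carrier L) (carrier M)}"

definition e_isomorphic :: "('a, 'm) e_struct_scheme \<Rightarrow> ('b, 'n) e_struct_scheme \<Rightarrow> bool"
    (infix \<open>\<cong>\<^sub>\<epsilon>\<close> 60) where
  "L \<cong>\<^sub>\<epsilon> M \<longleftrightarrow> e_iso L M \<noteq> {}"

definition ord_rel :: "('a, 'm) monoid_scheme \<Rightarrow> ('a \<times> 'a) set" where
  "ord_rel G = {(a, b) \<in> carrier G \<times> carrier G. group.ord G a = group.ord G b}"

definition ord_reps :: "('a, 'm) monoid_scheme \<Rightarrow> 'a set \<Rightarrow> bool" where
  "ord_reps G R \<longleftrightarrow> R \<subseteq> carrier G \<and> (\<forall>C \<in> carrier G // ord_rel G. \<exists>!r. r \<in> R \<inter> C)"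

definition rep_of_ord :: "('a, 'm) monoid_scheme \<Rightarrow> 'a set \<Rightarrow> nat \<Rightarrow> 'a" where
  "rep_of_ord G R d = (THE r. r \<in> R \<and> group.ord G r = d)"

definition rep_meet :: "('a, 'm) monoid_scheme \<Rightarrow> 'a set \<Rightarrow> 'a \<Rightarrow> 'a \<Rightarrow> 'a" where
  "rep_meet G R r s = rep_of_ord G R (gcd (group.ord G r) (group.ord G s))"

definition rep_join :: "('a, 'm) monoid_scheme \<Rightarrow> 'a set \<Rightarrow> 'a \<Rightarrow> 'a \<Rightarrow> 'a" where
  "rep_join G R r s = rep_of_ord G R (lcm (group.ord G r) (group.ord G s))"

definition ord_eps :: "('a, 'm) monoid_scheme \<Rightarrow> 'a set \<Rightarrow> 'a \<Rightarrow> 'a" where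
  "ord_eps G R a = rep_of_ord G R (group.ord G a)"

text \<open>The order canonical E-lattice on \<open>G\<close>, for a chosen set \<open>R\<close> of representatives of the classes
  of elements of equal order. The \<open>THE\<close> in \<open>rep_of_ord\<close> is meaningful at the greatest common divisor
  and the least common multiple of two element orders because in a finite abelian group these
  are again element orders; see \<open>canonical_e_lattice_order_e_lattice\<close>.\<close>

definition order_e_lattice :: "('a, 'm) monoid_scheme \<Rightarrow> 'a set \<Rightarrow> 'a e_struct" where
  "order_e_lattice G R = \<lparr>carrier = carrier G,
     eps = ord_eps G R,
     emeet = (\<lambda>a b. rep_meet G R (ord_eps G R a) (ord_eps G R b)),
     ejoin = (\<lambda>a b. rep_join G R (ord_eps G R a) (ord_eps G R b))\<rparr>"

lemma (in comm_group) ord_mult_coprime: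
  assumes xy: "x \<in> carrier G" "y \<in> carrier G" and cop: "coprime (ord x) (ord y)"
  shows "ord (x \<otimes> y) = ord x * ord y"
proof (rule dvd_antisym)
  show "ord (x \<otimes> y) dvd ord x * ord y"
    using xy by (rule abelian_ord_mul_divides)
  have *: "ord u dvd ord (u \<otimes> v)"
    if uv: "u \<in> carrier G" "v \<in> carrier G" "coprime (ord u) (ord v)" for u v
  proof -
    let ?n = "ord (u \<otimes> v) * ord v"
    have "(u \<otimes> v) [^] ?n = \<one>" "v [^] ?n = \<one>"
      using uv by (auto simp: pow_eq_id)
    then have "u [^] ?n = \<one>"
      using uv by (simp add: nat_pow_distrib)
    then have "ord u dvd ?n"
      using uv by (simp add: pow_eq_id)
    then show ?thesis
      using uv(3) by (simp add: coprime_dvd_mult_left_iff)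
  qed
  have "ord x dvd ord (x \<otimes> y)" "ord y dvd ord (x \<otimes> y)"
    using *[of x y] *[of y x] xy cop by (auto simp: m_comm coprime_commute)
  then show "ord x * ord y dvd ord (x \<otimes> y)"
    using cop by (simp add: divides_mult)
qed

lemma (in comm_group) ex_ord_dvd_lcm:
  assumes fin: "finite (carrier G)" and ab: "a \<in> carrier G" "b \<in> carrier G"
    and "d dvd lcm (ord a) (ord b)"
  shows "\<exists>c \<in> carrier G. ord c = d"
  using assms(4)
proof (induction d rule: less_induct)
  case (less d)
  have pos: "ord a > 0" "ord b > 0"
    using ord_ge_1[OF fin] ab by (auto simp: Suc_le_eq)
  then have d0: "d > 0"
    using less.prems by (auto intro!: Nat.gr0I)
  show ?case
  proof (cases "d = 1")
    case True
    then show ?thesis using ord_id by blast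
  next
    case False
    then obtain p where p: "Factorial_Ring.prime p" "p dvd d"
      using prime_factor_nat by blast
    define k where "k = multiplicity p d"
    obtain e where e: "d = p ^ k * e" "\<not> p dvd e"
      using multiplicity_decompose'[of d p] d0 not_prime_unit[of p] p(1) unfolding k_def
      by blast
    have k: "k > 0"
      using p d0 by (simp add: k_def prime_multiplicity_gt_zero_iff)
    have pk: "p ^ k > 1"
      using prime_gt_1_nat[OF p(1)] k by (rule one_less_power)
    have "e < d"
      using e(1) d0 pk by simp
    moreover have "e dvd lcm (ord a) (ord b)"
      using less.prems e(1) dvd_mult_right by blast
    ultimately obtain c where c: "c \<in> carrier G" "ord c = e"
      using less.IH by blast
    have "p ^ k dvd lcm (ord a) (ord b)"
      using less.prems e(1) dvd_mult_left by blast
    then have "k \<le> multiplicity p (lcm (ord a) (ord b))"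
      using pos not_prime_unit[of p] p(1)
      by (intro multiplicity_geI) (auto simp: lcm_eq_0_iff)
    also have "\<dots> = max (multiplicity p (ord a)) (multiplicity p (ord b))"
      using pos p(1) by (intro multiplicity_lcm) auto
    finally have "p ^ k dvd ord a \<or> p ^ k dvd ord b"
      by (auto simp: le_max_iff_disj multiplicity_dvd')
    then obtain u where u: "u \<in> carrier G" "p ^ k dvd ord u" "ord u > 0"
      using ab pos by blast
    define v where "v = u [^] (ord u div p ^ k)"
    obtain t where t: "ord u = p ^ k * t"
      using u(2) by (rule dvdE)
    have "ord u div p ^ k = t" "t \<noteq> 0" "t dvd ord u" "ord u div t = p ^ k"
      using t u(3) pk by simp_all
    then have v: "v \<in> carrier G" "ord v = p ^ k"
      using u(1) ord_pow[of u t] by (simp_all add: v_def)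
    have "coprime (ord v) (ord c)"
      using v c e p(1) by (simp add: prime_imp_coprime coprime_power_left_iff)
    then have "ord (v \<otimes> c) = d"
      using ord_mult_coprime v c e(1) by simp
    then show ?thesis
      using v c by blast
  qed
qed

lemma ord_reps_ex1:
  assumes "ord_reps G R" and "a \<in> carrier G"
  shows "\<exists>!r. r \<in> R \<and> group.ord G r = group.ord G a"
proof -
  have "ord_rel G `` {a} \<in> carrier G // ord_rel G"
    using assms(2) by (rule quotientI)
  with assms(1) have "\<exists>!r. r \<in> R \<inter> ord_rel G `` {a}" and "R \<subseteq> carrier G"
    by (simp_all only: ord_reps_def)
  moreover have "r \<in> R \<inter> ord_rel G `` {a} \<longleftrightarrow> r \<in> R \<and> group.ord G r = group.ord G a" for r
    using assms(2) \<open>R \<subseteq> carrier G\<close> by (auto simp: ord_rel_def)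
  ultimately show ?thesis by simp
qed

lemma rep_of_ord:
  assumes "ord_reps G R" and "a \<in> carrier G" and "group.ord G a = d"
  shows "rep_of_ord G R d \<in> R" and "rep_of_ord G R d \<in> carrier G"
    and "group.ord G (rep_of_ord G R d) = d"
proof -
  have "rep_of_ord G R d \<in> R \<and> group.ord G (rep_of_ord G R d) = d"
    unfolding rep_of_ord_def
    using ord_reps_ex1[OF assms(1,2)] unfolding assms(3) by (rule theI')
  then show "rep_of_ord G R d \<in> R" "rep_of_ord G R d \<in> carrier G"
    "group.ord G (rep_of_ord G R d) = d"
    using assms(1) by (auto simp: ord_reps_def)
qed

lemma canonical_e_lattice_order_e_lattice:
  assumes "comm_group G" and fin: "finite (carrier G)" and R: "ord_reps G R"
  shows "canonical_e_lattice (order_e_lattice G R)"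
proof -
  interpret comm_group G by fact
  let ?rep = "rep_of_ord G R"
  have eps: "ord_eps G R a \<in> carrier G" "ord (ord_eps G R a) = ord a"
    if "a \<in> carrier G" for a
    using rep_of_ord[OF R that refl] by (auto simp: ord_eps_def)
  have meet: "?rep (gcd (ord a) (ord b)) \<in> carrier G"
      "ord (?rep (gcd (ord a) (ord b))) = gcd (ord a) (ord b)"
    and join: "?rep (lcm (ord a) (ord b)) \<in> carrier G"
      "ord (?rep (lcm (ord a) (ord b))) = lcm (ord a) (ord b)"
    if ab: "a \<in> carrier G" "b \<in> carrier G" for a b
  proof -
    obtain c where "c \<in> carrier G" "ord c = gcd (ord a) (ord b)"
      using ex_ord_dvd_lcm[OF fin ab, of "gcd (ord a) (ord b)"] by (auto intro: dvd_trans)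
    then show "?rep (gcd (ord a) (ord b)) \<in> carrier G"
      "ord (?rep (gcd (ord a) (ord b))) = gcd (ord a) (ord b)"
      using rep_of_ord[OF R] by blast+
    obtain c where "c \<in> carrier G" "ord c = lcm (ord a) (ord b)"
      using ex_ord_dvd_lcm[OF fin ab, of "lcm (ord a) (ord b)"] by auto
    then show "?rep (lcm (ord a) (ord b)) \<in> carrier G"
      "ord (?rep (lcm (ord a) (ord b))) = lcm (ord a) (ord b)"
      using rep_of_ord[OF R] by blast+
  qed
  have ord_absorb: "gcd m (lcm m n) = m" "lcm m (gcd m n) = m" for m n :: nat
    by (simp_all add: gcd_proj1_iff lcm_proj1_iff)
  let ?L = "order_e_lattice G R"
  have sel: "carrier ?L = carrier G" "eps ?L = (\<lambda>a. ?rep (ord a))"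
    "\<And>a b. \<lbrakk>a \<in> carrier G; b \<in> carrier G\<rbrakk> \<Longrightarrow> emeet ?L a b = ?rep (gcd (ord a) (ord b))"
    "\<And>a b. \<lbrakk>a \<in> carrier G; b \<in> carrier G\<rbrakk> \<Longrightarrow> ejoin ?L a b = ?rep (lcm (ord a) (ord b))"
    using eps by (auto simp: order_e_lattice_def rep_meet_def rep_join_def ord_eps_def)
  have rep: "?rep (ord a) \<in> carrier G" if "a \<in> carrier G" for a
    using eps that by (simp add: ord_eps_def)
  show ?thesis
  proof
    show "carrier ?L \<noteq> {}"
      using one_closed sel(1) by blast
  next
    fix a assume a: "a \<in> carrier ?L"
    show "eps ?L a \<in> carrier ?L" "emeet ?L a a = eps ?L a" "ejoin ?L a a = eps ?L a"
      using a rep by (simp_all add: sel)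
  next
    fix a b assume "a \<in> carrier ?L" "b \<in> carrier ?L"
    then have ab: "a \<in> carrier G" "b \<in> carrier G"
      by (simp_all only: sel)
    show "emeet ?L a b \<in> carrier ?L" "ejoin ?L a b \<in> carrier ?L"
      using ab by (simp_all add: sel meet join)
    show "emeet ?L a b = emeet ?L b a" "ejoin ?L a b = ejoin ?L b a"
      using ab by (simp_all add: sel gcd.commute lcm.commute)
    show "emeet ?L a (ejoin ?L a b) = eps ?L a" "ejoin ?L a (emeet ?L a b) = eps ?L a"
      using ab by (simp_all add: sel meet join ord_absorb)
    show "emeet ?L a b \<in> e_Fix ?L" "ejoin ?L a b \<in> e_Fix ?L"
      using ab by (simp_all add: e_Fix_def sel meet join)
  next
    fix a b c assume "a \<in> carrier ?L" "b \<in> carrier ?L" "c \<in> carrier ?L"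
    then have "a \<in> carrier G" "b \<in> carrier G" "c \<in> carrier G"
      by (simp_all only: sel)
    then show "emeet ?L a (emeet ?L b c) = emeet ?L (emeet ?L a b) c"
      "ejoin ?L a (ejoin ?L b c) = ejoin ?L (ejoin ?L a b) c"
      by (simp_all add: sel meet join gcd.assoc lcm.assoc)
  qed
qed

end

theory Submission
  imports Defs
begin

text \<open>
  The lattice remembers exactly which element orders divide which:
  \<open>a \<sqinter>\<^sub>\<epsilon> b = \<epsilon> a\<close> holds if and only if the order of \<open>a\<close> divides that of \<open>b\<close>
  (\<open>emeet_eq_eps_iff_ord_dvd\<close>). So an isomorphism of the lattices is a bijection \<open>f\<close> that preserves
  and reflects divisibility of orders. The order lattice alone would not determine the orders: a
  permutation of the primes dividing the exponent can be an automorphism of it. What rules this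
  out is that \<open>f\<close> also preserves cardinalities. The elements whose order divides \<open>ord a\<close> form the
  torsion subgroup of exponent dividing \<open>ord a\<close>, and by the theorems of Cauchy and Lagrange the primes
  dividing its cardinality are those dividing \<open>ord a\<close>. Hence \<open>ord a\<close> and \<open>ord (f a)\<close> have
  the same prime divisors. Climbing the chain \<open>1, p, p\<^sup>2, \<dots>\<close> then shows that they have the same
  prime power divisors, so they are equal (\<open>ord_eq_if_ord_dvd_iff\<close>).

  It remains that a finite abelian group is determined by the number of solutions of \<open>x\<^sup>d = \<one>\<close> for
  each \<open>d\<close> (\<open>comm_group_iso_if_card_torsion_eq\<close>). These numbers determine the exponent \<open>e\<close>, a
  cyclic subgroup of order \<open>e\<close> is a direct factor
  (\<open>cyclic_exponent_subgroup_has_complement\<close>), and the numbers are multiplicative over direct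
  products, so the complementary factors of the two groups have the same numbers again and induction
  on the cardinality applies.

  Conversely, a group isomorphism preserves orders but need not carry the chosen representatives to
  each other. Since it may be changed arbitrarily inside each class of elements of equal order, one
  transposition per class repairs this (\<open>e_isomorphic_order_e_lattice_if_iso\<close>).
\<close>

section \<open>Torsion subgroups and their cardinalities\<close>

definition torsion :: "('a, 'm) monoid_scheme \<Rightarrow> nat \<Rightarrow> 'a set" where
  "torsion G d = {x \<in> carrier G. x [^]\<^bsub>G\<^esub> d = \<one>\<^bsub>G\<^esub>}"

lemma (in group) torsion_eq_ord_dvd: "torsion G d = {x \<in> carrier G. ord x dvd d}"
  by (auto simp: torsion_def pow_eq_id)

lemma (in comm_group) subgroup_torsion: "subgroup (torsion G d) G"
  by (rule subgroupI) (auto simp: torsion_def nat_pow_inv nat_pow_distrib)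

lemma (in group) ord_subgroup_generated:
  "group.ord (subgroup_generated G S) x = ord x"
  by (simp add: group.ord_def[OF group_subgroup_generated] ord_def pow_subgroup_generated)

text \<open>Cauchy's theorem, read off from Sylow's: a subgroup of order \<open>p\<close> has no element orders other
  than \<open>1\<close> and \<open>p\<close>.\<close>

lemma (in group) exists_ord_prime:
  assumes "finite (carrier G)" and p: "Factorial_Ring.prime p" and "p dvd order G"
  obtains u where "u \<in> carrier G" "ord u = p"
proof -
  obtain m where "order G = p ^ 1 * m"
    using assms(3) by auto
  then obtain P where P: "subgroup P G" "card P = p"
    using sylow_thm[OF p is_group _ assms(1), of 1 m] by auto
  have "P \<noteq> {\<one>}"
    using P(2) prime_gt_1_nat[OF p] by auto
  then obtain u where u: "u \<in> P" "u \<noteq> \<one>"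
    using subgroup.one_closed[OF P(1)] by blast
  have uG: "u \<in> carrier G"
    using u P(1) subgroup.mem_carrier by metis
  interpret P: group "subgroup_generated G P"
    by simp
  have carr: "carrier (subgroup_generated G P) = P"
    using P(1) by (rule subgroup.carrier_subgroup_generated_subgroup)
  have "ord u dvd p"
    using P.ord_dvd_group_order[of u] u(1) P(2) by (simp add: carr order_def ord_subgroup_generated)
  moreover have "ord u \<noteq> 1"
    using ord_eq_1 uG u(2) by blast
  ultimately have "ord u = p"
    using p by (auto simp: prime_nat_iff)
  with uG show ?thesis by (rule that)
qed

text \<open>The cardinality of a set of elements thus reveals the primes in \<open>ord a\<close>, which the order
  lattice by itself does not. Cauchy's theorem inside the torsion subgroup gives one direction. For
  the other, \<open>a\<close> lies in that subgroup, so \<open>ord a\<close> divides its cardinality.\<close>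

lemma (in comm_group) prime_dvd_card_torsion_iff:
  assumes fin: "finite (carrier G)" and p: "Factorial_Ring.prime p" and a: "a \<in> carrier G"
  shows "p dvd card (torsion G (ord a)) \<longleftrightarrow> p dvd ord a"
proof -
  let ?T = "subgroup_generated G (torsion G (ord a))"
  interpret T: group ?T
    by simp
  have carr: "carrier ?T = torsion G (ord a)"
    using subgroup_torsion by (rule subgroup.carrier_subgroup_generated_subgroup)
  have sub: "torsion G (ord a) \<subseteq> carrier G"
    by (auto simp: torsion_def)
  show ?thesis
  proof
    assume "p dvd card (torsion G (ord a))"
    then obtain u where "u \<in> carrier ?T" "T.ord u = p"
      using T.exists_ord_prime[OF _ p] fin sub carr by (metis finite_subset order_def)
    then show "p dvd ord a"
      unfolding carr ord_subgroup_generated by (auto simp: torsion_eq_ord_dvd)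
  next
    assume "p dvd ord a"
    moreover have "ord a dvd card (torsion G (ord a))"
      using T.ord_dvd_group_order[of a] a
      unfolding order_def carr ord_subgroup_generated by (simp add: torsion_eq_ord_dvd)
    ultimately show "p dvd card (torsion G (ord a))"
      by (rule dvd_trans)
  qed
qed

lemma iso_pow_eq_one_iff:
  assumes "group G" "group H" and f: "f \<in> iso G H" and x: "x \<in> carrier G"
  shows "f x [^]\<^bsub>H\<^esub> (n::nat) = \<one>\<^bsub>H\<^esub> \<longleftrightarrow> x [^]\<^bsub>G\<^esub> n = \<one>\<^bsub>G\<^esub>"
proof -
  interpret G: group G by fact
  interpret H: group H by fact
  have hom: "f \<in> hom G H" and inj: "inj_on f (carrier G)"
    using f by (auto simp: iso_def bij_betw_def)
  have "f x [^]\<^bsub>H\<^esub> n = f (x [^]\<^bsub>G\<^esub> n)"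
    using hom_nat_pow[OF hom x assms(1,2)] by simp
  moreover have "\<one>\<^bsub>H\<^esub> = f \<one>\<^bsub>G\<^esub>"
    using hom_one[OF hom assms(1,2)] by simp
  ultimately show ?thesis
    using inj_on_eq_iff[OF inj, of "x [^]\<^bsub>G\<^esub> n" "\<one>\<^bsub>G\<^esub>"] x by simp
qed

lemma iso_ord:
  assumes "group G" "group H" "f \<in> iso G H" and x: "x \<in> carrier G"
  shows "group.ord H (f x) = group.ord G x"
proof -
  have "f x \<in> carrier H"
    using assms by (auto simp: iso_def bij_betw_def)
  then show ?thesis
    using iso_pow_eq_one_iff[OF assms] group.pow_eq_id[OF assms(1) x] group.ord_unique[OF assms(2)]
    by blast
qed

lemma card_torsion_iso:
  assumes "G \<cong> H" "group G" "group H"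
  shows "card (torsion G d) = card (torsion H d)"
proof -
  obtain f where f: "f \<in> iso G H"
    using assms(1) by (auto simp: is_iso_def)
  then have bij: "bij_betw f (carrier G) (carrier H)"
    by (simp add: iso_def)
  have "torsion G d = {x \<in> carrier G. f x [^]\<^bsub>H\<^esub> d = \<one>\<^bsub>H\<^esub>}"
    using iso_pow_eq_one_iff[OF assms(2,3) f] by (auto simp: torsion_def)
  then have "bij_betw f (torsion G d) (torsion H d)"
    using bij_betw_Collect[OF bij refl, of "\<lambda>y. y [^]\<^bsub>H\<^esub> d = \<one>\<^bsub>H\<^esub>"] by (simp add: torsion_def)
  then show ?thesis
    by (rule bij_betw_same_card)
qed

lemma torsion_DirProd: "torsion (G \<times>\<times> H) d = torsion G d \<times> torsion H d"
proof -
  have "(x, y) [^]\<^bsub>G \<times>\<times> H\<^esub> d = (x [^]\<^bsub>G\<^esub> d, y [^]\<^bsub>H\<^esub> d)" for x y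
    by (induction d) (simp_all add: nat_pow_def)
  then show ?thesis
    by (auto simp: torsion_def)
qed

section \<open>Cyclic direct factors of maximal order\<close>

text \<open>Element orders are closed under \<open>lcm\<close>, so the largest one is a multiple of all others.\<close>

lemma (in comm_group) exists_ord_eq_exponent:
  assumes fin: "finite (carrier G)"
  obtains x where "x \<in> carrier G" "\<And>g. g \<in> carrier G \<Longrightarrow> ord g dvd ord x"
proof -
  have fin_ord: "finite (ord ` carrier G)" "ord ` carrier G \<noteq> {}"
    using fin by auto
  then obtain x where x: "x \<in> carrier G" "ord x = Max (ord ` carrier G)"
    by (metis Max_in imageE)
  have "ord g dvd ord x" if g: "g \<in> carrier G" for g
  proof -
    obtain c where c: "c \<in> carrier G" "ord c = lcm (ord x) (ord g)"
      using ex_ord_dvd_lcm[OF fin x(1) g dvd_refl] by blast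
    have "ord c \<le> ord x"
      unfolding x(2) using c(1) fin_ord(1) by (intro Max_ge) auto
    moreover have "0 < ord c"
      using ord_ge_1[OF fin c(1)] by simp
    moreover have "ord x dvd ord c" "ord g dvd ord c"
      by (simp_all add: c(2))
    ultimately show ?thesis
      by (metis dvd_imp_le le_antisym)
  qed
  with x(1) show ?thesis by (rule that)
qed

text \<open>
  Take \<open>H\<close> maximal among the subgroups that meet \<open>C = \<langle>x\<rangle>\<close> trivially, and suppose some \<open>g\<close> lies
  outside \<open>P = H C\<close>. Let \<open>m\<close> be the order of \<open>g\<close> modulo \<open>P\<close>, so that \<open>g\<^sup>m = h x\<^sup>k\<close>. Raising this to
  the power \<open>ord x / m\<close> kills the left side, and since \<open>H\<close> and \<open>C\<close> meet trivially this forces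
  \<open>m\<close> to divide \<open>k\<close>; here it matters that \<open>ord x\<close> is a multiple of \<open>ord g\<close>. Hence \<open>g\<close> can be corrected
  by a power of \<open>x\<close> to some \<open>g'\<close> outside \<open>P\<close> with \<open>g'\<^sup>m \<in> H\<close>. Then \<open>\<langle>H, g'\<rangle>\<close> is a larger subgroup
  that still meets \<open>C\<close> trivially, contradicting the choice of \<open>H\<close>.
\<close>

lemma (in comm_group) cyclic_exponent_subgroup_has_complement:
  assumes fin: "finite (carrier G)" and x: "x \<in> carrier G"
    and exponent: "\<And>g. g \<in> carrier G \<Longrightarrow> ord g dvd ord x"
  obtains H where "subgroup H G" "H \<inter> range (\<lambda>k::int. x [^] k) \<subseteq> {\<one>}"
    "H <#> range (\<lambda>k::int. x [^] k) = carrier G"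
proof -
  define C where "C = range (\<lambda>k::int. x [^] k)"
  have C: "subgroup C G"
    unfolding C_def using x by (rule subgroup_of_powers)
  define S where "S = {H. subgroup H G \<and> H \<inter> C \<subseteq> {\<one>}}"
  have "finite S"
    by (rule finite_subset[of _ "Pow (carrier G)"]) (auto simp: S_def fin dest: subgroup.subset)
  moreover have "{\<one>} \<in> S"
    by (simp add: S_def triv_subgroup)
  ultimately obtain H where "H \<in> S" and max: "\<And>K. K \<in> S \<Longrightarrow> H \<subseteq> K \<Longrightarrow> H = K"
    using finite_has_maximal[of S] by blast
  then have H: "subgroup H G" and HC: "H \<inter> C \<subseteq> {\<one>}"
    by (auto simp: S_def)
  have H_carr: "h \<in> carrier G" if "h \<in> H" for h
    using H that by (rule subgroup.mem_carrier)
  define P where "P = H <#> C"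
  have P: "subgroup P G"
    unfolding P_def using H C by (rule mult_subgroups)
  have P_E: "\<exists>h\<in>H. \<exists>k::int. y = h \<otimes> x [^] k" if "y \<in> P" for y
    using that by (auto simp: P_def C_def set_mult_def)
  have HP: "h \<in> P" if "h \<in> H" for h
  proof -
    have "h \<otimes> \<one> \<in> P"
      using that subgroup.one_closed[OF C] unfolding P_def set_mult_def by blast
    then show ?thesis
      using H_carr[OF that] by simp
  qed
  have CP: "x [^] (k::int) \<in> P" for k
  proof -
    have "\<one> \<otimes> x [^] k \<in> P"
      using subgroup.one_closed[OF H] unfolding P_def C_def set_mult_def by blast
    then show ?thesis
      using x by simp
  qed
  have "g \<in> P" if g: "g \<in> carrier G" for g
  proof (rule ccontr)
    assume "g \<notin> P"
    define m where "m = (LEAST n. 0 < n \<and> g [^] (n::nat) \<in> P)"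
    have e0: "0 < ord x"
      using ord_ge_1[OF fin x] by simp
    have ge: "g [^] ord x = \<one>"
      using exponent[OF g] g by (simp add: pow_eq_id)
    have "0 < ord x \<and> g [^] ord x \<in> P"
      using e0 ge subgroup.one_closed[OF P] by simp
    then have m: "0 < m" "g [^] m \<in> P"
      unfolding m_def by (metis (mono_tags, lifting) LeastI)+
    have m_dvd: "int m dvd j" if j: "g [^] (j::int) \<in> P" for j
    proof -
      have "g [^] (j mod int m) = g [^] (j + int m * (- (j div int m)))"
        by (simp add: minus_mult_div_eq_mod)
      also have "\<dots> = g [^] j \<otimes> (g [^] m) [^] (- (j div int m))"
        by (simp only: int_pow_mult[OF g] int_pow_pow[OF g] int_pow_int[symmetric])
      also have "\<dots> \<in> P"
        using j subgroup_int_pow_closed[OF P m(2)] by (rule subgroup.m_closed[OF P])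
      finally have "g [^] nat (j mod int m) \<in> P"
        using m(1) by (simp add: pow_nat)
      moreover have "nat (j mod int m) < m"
        using m(1) by (simp add: nat_less_iff)
      ultimately have "nat (j mod int m) = 0"
        using not_less_Least[of "nat (j mod int m)" "\<lambda>n. 0 < n \<and> g [^] n \<in> P", folded m_def]
        by simp
      moreover have "0 \<le> j mod int m"
        using m(1) by simp
      ultimately show ?thesis
        by (simp add: dvd_eq_mod_eq_0)
    qed
    have "int m dvd int (ord x)"
      using m_dvd[of "int (ord x)"] ge subgroup.one_closed[OF P] by (simp add: int_pow_int)
    then obtain t where t: "ord x = m * t"
      by auto
    \<comment> \<open>The exponent \<open>k\<close> is a multiple of \<open>m\<close>: compare the two sides after raising to the power \<open>t\<close>.\<close>
    obtain h k where hk: "h \<in> H" "g [^] m = h \<otimes> x [^] (k::int)"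
      using P_E[OF m(2)] by blast
    have hG: "h \<in> carrier G"
      using hk(1) by (rule H_carr)
    have "\<one> = (g [^] m) [^] int t"
      using ge g by (simp add: t nat_pow_pow int_pow_int)
    also have "\<dots> = h [^] int t \<otimes> x [^] (k * int t)"
      using hG x by (simp add: hk(2) int_pow_mult_distrib m_comm int_pow_pow)
    finally have "x [^] (k * int t) = inv (h [^] int t)"
      using hG x by (metis inv_equality int_pow_closed inv_inv inv_closed m_comm)
    moreover have "inv (h [^] int t) \<in> H"
      using H hk(1) by (simp add: subgroup.m_inv_closed subgroup_int_pow_closed)
    moreover have "x [^] (k * int t) \<in> C"
      by (simp add: C_def)
    ultimately have "x [^] (k * int t) = \<one>"
      using HC by auto
    then have "int m * int t dvd k * int t"
      using x t by (simp add: int_pow_eq_id)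
    moreover have "t \<noteq> 0"
      using t e0 by auto
    ultimately obtain l where l: "k = int m * l"
      by auto
    \<comment> \<open>The correction by \<open>x\<close> to the power \<open>- k / m\<close> removes the factor \<open>x [^] k\<close> from \<open>g [^] m\<close>.\<close>
    define g' where "g' = g \<otimes> x [^] (- l)"
    have g': "g' \<in> carrier G"
      using g x by (simp add: g'_def)
    have g_eq: "g [^] j = g' [^] j \<otimes> x [^] (l * j)" for j :: int
    proof -
      have "g = g' \<otimes> x [^] l"
        using g x by (simp add: g'_def m_assoc flip: int_pow_mult)
      then have "g [^] j = (g' \<otimes> x [^] l) [^] j"
        by simp
      also have "\<dots> = g' [^] j \<otimes> x [^] (l * j)"
        using g' x by (simp add: int_pow_mult_distrib m_comm int_pow_pow)
      finally show ?thesis .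
    qed
    have g'm: "g' [^] int m = h"
    proof -
      have "g' [^] int m \<otimes> x [^] k = h \<otimes> x [^] k"
        using g_eq[of "int m"] hk(2) l by (simp add: mult.commute int_pow_int)
      then show ?thesis
        using g' hG x by simp
    qed
    define D where "D = range (\<lambda>j::int. g' [^] j)"
    have D: "subgroup D G"
      unfolding D_def using g' by (rule subgroup_of_powers)
    have "H <#> D \<in> S"
    proof -
      \<comment> \<open>If \<open>u \<otimes> g' [^] j \<in> C\<close> with \<open>u \<in> H\<close>, then \<open>g [^] j \<in> P\<close>, so \<open>m\<close> divides \<open>j\<close> and the product is in \<open>H\<close>.\<close>
      have "y = \<one>" if y: "y \<in> H <#> D" "y \<in> C" for y
      proof -
        obtain u j where u: "u \<in> H" "y = u \<otimes> g' [^] (j::int)"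
          using y(1) by (auto simp: set_mult_def D_def)
        have uG: "u \<in> carrier G"
          using u(1) by (rule H_carr)
        obtain i where i: "y = x [^] (i::int)"
          using y(2) by (auto simp: C_def)
        have "g' [^] j = inv u \<otimes> y"
          using uG g' u(2) by (simp flip: m_assoc)
        then have "g' [^] j \<in> P"
          using u(1) i P CP HP H by (simp add: subgroup.m_closed subgroup.m_inv_closed)
        then have "g [^] j \<in> P"
          using g_eq[of j] CP P by (simp add: subgroup.m_closed)
        then obtain q where q: "j = int m * q"
          using m_dvd by blast
        have "g' [^] j = h [^] q"
          using g' g'm q by (simp flip: int_pow_pow)
        then have "y \<in> H"
          using u H hk(1) by (simp add: subgroup.m_closed subgroup_int_pow_closed)
        with y(2) HC show ?thesis by blast
      qed
      then show ?thesis
        using mult_subgroups[OF H D] by (auto simp: S_def)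
    qed
    moreover have "H \<subseteq> H <#> D"
      using subgroup.one_closed[OF D] H_carr by (force simp: set_mult_def)
    ultimately have "H = H <#> D"
      by (rule max)
    moreover have "g' \<in> H <#> D"
    proof -
      have "g' \<in> D"
        unfolding D_def using g' by (metis int_pow_1 rangeI)
      then show ?thesis
        using subgroup.one_closed[OF H] g' by (force simp: set_mult_def)
    qed
    ultimately have "g' \<in> P"
      using HP by blast
    then have "g' \<otimes> x [^] l \<in> P"
      using CP P by (simp add: subgroup.m_closed)
    then show False
      using g_eq[of 1] g g' \<open>g \<notin> P\<close> by simp
  qed
  then have "P = carrier G"
    using subgroup.subset[OF P] by blast
  with H HC show ?thesis
    by (intro that[of H]) (simp_all add: P_def C_def)
qed

lemma (in group) integer_mod_group_iso_powers:
  assumes fin: "finite (carrier G)" and x: "x \<in> carrier G"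
  shows "integer_mod_group (ord x) \<cong> subgroup_generated G (range (\<lambda>k::int. x [^] k))"
proof -
  let ?C = "range (\<lambda>k::int. x [^] k)"
  have carr: "carrier (subgroup_generated G ?C) = ?C"
    using subgroup_of_powers[OF x] by (rule subgroup.carrier_subgroup_generated_subgroup)
  have pos: "0 < ord x"
    using ord_ge_1[OF fin x] by simp
  have pow_mod: "x [^] (k mod int (ord x)) = x [^] k" for k
    using x by (simp add: int_pow_eq mod_eq_dvd_iff[symmetric])
  have "(\<lambda>k. x [^] k) \<in> iso (integer_mod_group (ord x)) (subgroup_generated G ?C)"
  proof (rule isoI)
    show "(\<lambda>k. x [^] k) \<in> hom (integer_mod_group (ord x)) (subgroup_generated G ?C)"
      using x by (auto simp: hom_def carr pow_mod int_pow_mult)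
    have "inj_on (\<lambda>k::int. x [^] k) {0..<int (ord x)}"
    proof (rule inj_onI)
      fix i j :: int
      assume "i \<in> {0..<int (ord x)}" "j \<in> {0..<int (ord x)}" "x [^] i = x [^] j"
      then show "i = j"
        using x by (simp add: int_pow_eq mod_eq_dvd_iff[symmetric])
    qed
    moreover have "x [^] k \<in> (\<lambda>k. x [^] k) ` {0..<int (ord x)}" for k :: int
      using pos by (intro image_eqI[of _ _ "k mod int (ord x)"]) (simp_all add: pow_mod)
    ultimately show "bij_betw (\<lambda>k. x [^] k) (carrier (integer_mod_group (ord x)))
        (carrier (subgroup_generated G ?C))"
      using pos by (auto simp: bij_betw_def carr carrier_integer_mod_group)
  qed
  then show ?thesis
    by (rule is_isoI)
qed

text \<open>The cyclic factor is expressed by \<open>integer_mod_group\<close>, which depends on the order of \<open>x\<close> only,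
  so that two groups of equal exponent split off literally the same factor.\<close>

lemma (in comm_group) iso_cyclic_times_complement:
  assumes fin: "finite (carrier G)" and x: "x \<in> carrier G"
    and exponent: "\<And>g. g \<in> carrier G \<Longrightarrow> ord g dvd ord x"
  obtains H where "subgroup H G" "integer_mod_group (ord x) \<times>\<times> subgroup_generated G H \<cong> G"
proof -
  obtain H where H: "subgroup H G" "H \<inter> range (\<lambda>k::int. x [^] k) \<subseteq> {\<one>}"
    "H <#> range (\<lambda>k::int. x [^] k) = carrier G"
    using cyclic_exponent_subgroup_has_complement[OF assms] by blast
  let ?C = "range (\<lambda>k::int. x [^] k)"
  interpret group_disjoint_sum G H ?C
    using H(1) subgroup_of_powers[OF x] by (simp add: group_disjoint_sum_def)
  have "subgroup_generated G H \<times>\<times> subgroup_generated G ?C \<cong> G"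
    using iso_group_mul H(2,3) comm_group_axioms by (blast intro: is_isoI)
  moreover have "integer_mod_group (ord x) \<times>\<times> subgroup_generated G H
      \<cong> subgroup_generated G ?C \<times>\<times> subgroup_generated G H"
    using integer_mod_group_iso_powers[OF fin x]
    by (intro group.DirProd_iso_trans) simp_all
  moreover have "subgroup_generated G ?C \<times>\<times> subgroup_generated G H
      \<cong> subgroup_generated G H \<times>\<times> subgroup_generated G ?C"
    by (rule DirProd_commute_iso)
  ultimately have "integer_mod_group (ord x) \<times>\<times> subgroup_generated G H \<cong> G"
    by (metis iso_trans)
  with H(1) show ?thesis by (rule that)
qed

section \<open>Isomorphism from torsion cardinalities\<close>

text \<open>The exponent is the least \<open>d\<close>, with respect to divisibility, whose torsion subgroup is the whole
  group, so both groups have the same exponent and a common cyclic factor \<open>Z\<close> of that order. The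
  torsion of \<open>Z\<close> is nonempty, so its cardinality can be cancelled and the complements satisfy the
  hypothesis again.\<close>

lemma comm_group_iso_if_card_torsion_eq:
  fixes G :: "('a, 'm) monoid_scheme" and G' :: "('b, 'n) monoid_scheme"
  assumes "comm_group G" "finite (carrier G)" "comm_group G'" "finite (carrier G')"
    and "\<And>d. card (torsion G d) = card (torsion G' d)"
  shows "G \<cong> G'"
  using assms
proof (induction "card (carrier G)" arbitrary: G G' rule: less_induct)
  case less
  note fin = less.prems(2,4) and torsion_eq = less.prems(5)
  interpret G: comm_group G by fact
  interpret G': comm_group G' by fact
  have torsion_all: "torsion G (order G) = carrier G" "torsion G' (order G') = carrier G'"
    by (auto simp: torsion_def G.pow_order_eq_1 G'.pow_order_eq_1)
  have mono: "card (torsion G d) \<le> card (carrier G)" "card (torsion G' d) \<le> card (carrier G')" for d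
    using fin by (auto simp: torsion_def intro: card_mono)
  have card_eq: "card (carrier G) = card (carrier G')"
    using mono(1)[of "order G'"] mono(2)[of "order G"] torsion_eq torsion_all
    by (metis le_antisym)
  obtain x where x: "x \<in> carrier G" "\<And>g. g \<in> carrier G \<Longrightarrow> G.ord g dvd G.ord x"
    using G.exists_ord_eq_exponent[OF fin(1)] by blast
  obtain x' where x': "x' \<in> carrier G'" "\<And>g. g \<in> carrier G' \<Longrightarrow> G'.ord g dvd G'.ord x'"
    using G'.exists_ord_eq_exponent[OF fin(2)] by blast
  have "torsion G (G.ord x) = carrier G" "torsion G' (G'.ord x') = carrier G'"
    using x x' by (auto simp: G.torsion_eq_ord_dvd G'.torsion_eq_ord_dvd)
  then have "card (torsion G' (G.ord x)) = card (carrier G')"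
    "card (torsion G (G'.ord x')) = card (carrier G)"
    using card_eq torsion_eq by metis+
  then have "torsion G' (G.ord x) = carrier G'" "torsion G (G'.ord x') = carrier G"
    using fin by (simp_all add: card_subset_eq torsion_def)
  then have ord_eq: "G.ord x = G'.ord x'"
    using x(1) x'(1) by (auto simp: G.torsion_eq_ord_dvd G'.torsion_eq_ord_dvd intro: dvd_antisym)
  let ?Z = "integer_mod_group (G.ord x)"
  have Z_pos: "0 < G.ord x"
    using G.ord_ge_1[OF fin(1) x(1)] by simp
  show ?case
  proof (cases "G.ord x = 1")
    case True
    then have "carrier G = {\<one>\<^bsub>G\<^esub>}"
      using x(2) G.ord_eq_1 by auto
    moreover from this have "carrier G' = {\<one>\<^bsub>G'\<^esub>}"
      using card_eq G'.one_closed by (metis card_1_singletonE is_singletonI is_singleton_altdef singletonD)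
    ultimately have "(\<lambda>_. \<one>\<^bsub>G'\<^esub>) \<in> iso G G'"
      by (auto simp: iso_def hom_def bij_betw_def)
    then show ?thesis
      by (rule is_isoI)
  next
    case False
    obtain H where H: "subgroup H G" "?Z \<times>\<times> subgroup_generated G H \<cong> G"
      using G.iso_cyclic_times_complement[OF fin(1) x] by blast
    obtain H' where H': "subgroup H' G'" "?Z \<times>\<times> subgroup_generated G' H' \<cong> G'"
      using G'.iso_cyclic_times_complement[OF fin(2) x'] ord_eq by metis
    let ?H = "subgroup_generated G H" and ?H' = "subgroup_generated G' H'"
    have carr: "carrier ?H = H" "carrier ?H' = H'"
      using H(1) H'(1) by (simp_all add: subgroup.carrier_subgroup_generated_subgroup)
    have finH: "finite H" "finite H'"
      using H(1) H'(1) fin by (auto intro: finite_subset dest: subgroup.subset)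
    have card_Z: "card (carrier ?Z) = G.ord x"
      using Z_pos by (simp add: carrier_integer_mod_group)
    have "card (carrier G) = G.ord x * card H"
      using iso_same_card[OF H(2)] by (simp add: card_cartesian_product card_Z carr)
    moreover have "0 < card H"
      using finH subgroup.one_closed[OF H(1)] by (auto simp: card_gt_0_iff)
    ultimately have smaller: "card (carrier ?H) < card (carrier G)"
      using False Z_pos by (simp add: carr)
    have torsion_H: "card (torsion ?H d) = card (torsion ?H' d)" for d
    proof -
      have "card (torsion ?Z d) * card (torsion ?H d) = card (torsion G d)"
        using card_torsion_iso[OF H(2), of d]
        by (simp add: DirProd_group torsion_DirProd card_cartesian_product)
      moreover have "card (torsion ?Z d) * card (torsion ?H' d) = card (torsion G' d)"
        using card_torsion_iso[OF H'(2), of d]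
        by (simp add: DirProd_group torsion_DirProd card_cartesian_product)
      moreover have "0 < card (torsion ?Z d)"
      proof -
        have "finite (carrier ?Z)"
          using Z_pos by (simp add: carrier_integer_mod_group)
        then have "finite (torsion ?Z d)"
          by (simp add: torsion_def)
        moreover have "0 \<in> torsion ?Z d"
          by (simp add: torsion_def)
        ultimately show ?thesis
          by (auto simp: card_gt_0_iff)
      qed
      ultimately show ?thesis
        using torsion_eq[of d] by (metis mult_cancel1 less_not_refl)
    qed
    have "?H \<cong> ?H'"
      by (rule less.hyps[OF smaller])
        (simp_all add: G.abelian_subgroup_generated G'.abelian_subgroup_generated
          less.prems(1,3) carr finH torsion_H)
    then have "?Z \<times>\<times> ?H \<cong> ?Z \<times>\<times> ?H'"
      by (intro group.DirProd_iso_trans) simp_all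
    then have "?Z \<times>\<times> ?H \<cong> G'"
      using H'(2) by (rule iso_trans)
    moreover have "G \<cong> ?Z \<times>\<times> ?H"
      using group.iso_sym[OF _ H(2)] by (simp add: DirProd_group)
    ultimately show ?thesis
      by (rule iso_trans[rotated])
  qed
qed

section \<open>Bijections respecting divisibility of orders\<close>

text \<open>
  Such a bijection maps \<open>torsion G (ord b)\<close> onto \<open>torsion G' (ord (f b))\<close>, so the two orders have the
  same prime divisors. In particular, elements of order \<open>p ^ k\<close> go to elements whose order is a power
  of \<open>p\<close>. By induction on \<open>k\<close> that power is divisible by \<open>p ^ k\<close>: for an element \<open>c\<close> whose order is
  \<open>p ^ k\<close>, a proper divisor of \<open>ord b = p ^ Suc k\<close>, the order of \<open>f c\<close> is a proper divisor of that of
  \<open>f b\<close>.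
\<close>

lemma prime_power_dvd_ord_transfer:
  fixes G :: "('a, 'm) monoid_scheme" and G' :: "('b, 'n) monoid_scheme"
  assumes "comm_group G" "finite (carrier G)" "comm_group G'" "finite (carrier G')"
    and bij: "bij_betw f (carrier G) (carrier G')"
    and dvd: "\<And>a b. \<lbrakk>a \<in> carrier G; b \<in> carrier G\<rbrakk>
      \<Longrightarrow> group.ord G' (f a) dvd group.ord G' (f b) \<longleftrightarrow> group.ord G a dvd group.ord G b"
    and p: "Factorial_Ring.prime p" and "a \<in> carrier G" and "p ^ k dvd group.ord G a"
  shows "p ^ k dvd group.ord G' (f a)"
proof -
  interpret G: comm_group G by fact
  interpret G': comm_group G' by fact
  note fin = assms(2,4)
  have f: "f b \<in> carrier G'" if "b \<in> carrier G" for b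
    using bij that by (rule bij_betwE[THEN bspec])
  have same_primes: "q dvd G'.ord (f b) \<longleftrightarrow> q dvd G.ord b"
    if b: "b \<in> carrier G" and q: "Factorial_Ring.prime q" for b q
  proof -
    have "torsion G (G.ord b) = {c \<in> carrier G. G'.ord (f c) dvd G'.ord (f b)}"
      using dvd b by (auto simp: G.torsion_eq_ord_dvd)
    then have "bij_betw f (torsion G (G.ord b)) (torsion G' (G'.ord (f b)))"
      using bij_betw_Collect[OF bij refl, of "\<lambda>y. G'.ord y dvd G'.ord (f b)"]
      by (simp add: G'.torsion_eq_ord_dvd)
    then have "card (torsion G (G.ord b)) = card (torsion G' (G'.ord (f b)))"
      by (rule bij_betw_same_card)
    then show ?thesis
      using G.prime_dvd_card_torsion_iff[OF fin(1) q b]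
        G'.prime_dvd_card_torsion_iff[OF fin(2) q f[OF b]] by simp
  qed
  have prime_power: "p ^ k dvd G'.ord (f b)" if "b \<in> carrier G" "G.ord b = p ^ k" for b k
    using that
  proof (induction k arbitrary: b)
    case 0
    then show ?case by simp
  next
    case (Suc k)
    have "0 < G'.ord (f b)"
      using G'.ord_ge_1[OF fin(2) f[OF Suc.prems(1)]] by simp
    moreover have "q = p" if "Factorial_Ring.prime q" "q dvd G'.ord (f b)" for q
      using same_primes[OF Suc.prems(1) that(1)] that p Suc.prems(2)
      by (metis prime_dvd_power primes_dvd_imp_eq)
    moreover obtain j m where jm: "\<not> p dvd m" "G'.ord (f b) = m * p ^ j"
      using prime_power_canonical[OF p] calculation(1) by metis
    ultimately have "m = 1"
      using prime_factor_nat[of m] by (metis dvd_mult2)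
    with jm(2) have j: "G'.ord (f b) = p ^ j"
      by simp
    define c where "c = b [^]\<^bsub>G\<^esub> p"
    have c: "c \<in> carrier G" "G.ord c = p ^ k"
      using Suc.prems p prime_gt_0_nat[OF p] by (simp_all add: c_def G.ord_pow)
    have "p ^ k dvd G'.ord (f c)"
      using Suc.IH c by blast
    moreover have "G'.ord (f c) dvd p ^ j"
      using dvd[OF c(1) Suc.prems(1)] c Suc.prems j by simp
    moreover have "\<not> p ^ j dvd G'.ord (f c)"
      using dvd[OF Suc.prems(1) c(1)] c Suc.prems j prime_gt_1_nat[OF p]
      by (auto dest: dvd_imp_le)
    ultimately have "k < j"
      using prime_gt_1_nat[OF p] by (metis dvd_trans le_imp_power_dvd not_le)
    then show ?case
      unfolding j by (intro le_imp_power_dvd) simp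
  qed
  obtain b where b: "b \<in> carrier G" "G.ord b = p ^ k"
    using G.ex_ord_dvd_lcm[OF fin(1) assms(8,8)] assms(9) by auto
  have "p ^ k dvd G'.ord (f b)"
    using b by (rule prime_power)
  also have "\<dots> dvd G'.ord (f a)"
    using dvd[OF b(1) assms(8)] b(2) assms(9) by simp
  finally show ?thesis .
qed

lemma ord_eq_if_ord_dvd_iff:
  fixes G :: "('a, 'm) monoid_scheme" and G' :: "('b, 'n) monoid_scheme"
  assumes "comm_group G" "finite (carrier G)" "comm_group G'" "finite (carrier G')"
    and bij: "bij_betw f (carrier G) (carrier G')"
    and dvd: "\<And>a b. \<lbrakk>a \<in> carrier G; b \<in> carrier G\<rbrakk>
      \<Longrightarrow> group.ord G' (f a) dvd group.ord G' (f b) \<longleftrightarrow> group.ord G a dvd group.ord G b"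
    and a: "a \<in> carrier G"
  shows "group.ord G' (f a) = group.ord G a"
proof -
  interpret G: comm_group G by fact
  interpret G': comm_group G' by fact
  have fa: "f a \<in> carrier G'"
    using bij a by (rule bij_betwE[THEN bspec])
  let ?g = "inv_into (carrier G) f"
  have inv: "?g y \<in> carrier G" "f (?g y) = y" if "y \<in> carrier G'" for y
    using bij that by (auto simp: bij_betw_def inv_into_into f_inv_into_f)
  have gfa: "?g (f a) = a"
    using bij a by (auto simp: bij_betw_def)
  have dvd': "G.ord (?g c) dvd G.ord (?g d) \<longleftrightarrow> G'.ord c dvd G'.ord d"
    if "c \<in> carrier G'" "d \<in> carrier G'" for c d
    using dvd[of "?g c" "?g d"] inv that by simp
  have pos: "G.ord a \<noteq> 0" "G'.ord (f a) \<noteq> 0"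
    using G.ord_ge_1[OF assms(2) a] G'.ord_ge_1[OF assms(4) fa] by auto
  have to: "p ^ k dvd G'.ord (f a)" if "Factorial_Ring.prime p" "p ^ k dvd G.ord a" for p k
    using prime_power_dvd_ord_transfer[OF assms(1-6) that(1) a that(2)] .
  have "p ^ k dvd G.ord (?g (f a))" if "Factorial_Ring.prime p" "p ^ k dvd G'.ord (f a)" for p k
    using prime_power_dvd_ord_transfer[OF assms(3,4,1,2) bij_betw_inv_into[OF bij] dvd'
        that(1) fa that(2)] by blast
  then have fro: "p ^ k dvd G.ord a" if "Factorial_Ring.prime p" "p ^ k dvd G'.ord (f a)" for p k
    using that gfa by metis
  have "multiplicity p (G'.ord (f a)) = multiplicity p (G.ord a)"
    if "Factorial_Ring.prime p" for p
  proof (rule antisym)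
    have "\<not> is_unit p"
      using that by auto
    then show "multiplicity p (G'.ord (f a)) \<le> multiplicity p (G.ord a)"
      using pos by (intro multiplicity_geI fro[OF that] multiplicity_dvd)
    show "multiplicity p (G.ord a) \<le> multiplicity p (G'.ord (f a))"
      using pos \<open>\<not> is_unit p\<close> by (intro multiplicity_geI to[OF that] multiplicity_dvd)
  qed
  then show ?thesis
    using pos by (simp add: multiplicity_eq_nat)
qed

section \<open>Isomorphisms of order canonical lattices\<close>

lemma order_e_lattice_simps:
  assumes R: "ord_reps G R"
  shows "carrier (order_e_lattice G R) = carrier G"
    and "eps (order_e_lattice G R) a = rep_of_ord G R (group.ord G a)"
    and "\<lbrakk>a \<in> carrier G; b \<in> carrier G\<rbrakk> \<Longrightarrow> emeet (order_e_lattice G R) a b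
      = rep_of_ord G R (gcd (group.ord G a) (group.ord G b))"
    and "\<lbrakk>a \<in> carrier G; b \<in> carrier G\<rbrakk> \<Longrightarrow> ejoin (order_e_lattice G R) a b
      = rep_of_ord G R (lcm (group.ord G a) (group.ord G b))"
  using rep_of_ord(3)[OF R _ refl]
  by (simp_all add: order_e_lattice_def rep_meet_def rep_join_def ord_eps_def)

lemma emeet_eq_eps_iff_ord_dvd:
  assumes "comm_group G" and fin: "finite (carrier G)" and R: "ord_reps G R"
    and ab: "a \<in> carrier G" "b \<in> carrier G"
  shows "emeet (order_e_lattice G R) a b = eps (order_e_lattice G R) a
    \<longleftrightarrow> group.ord G a dvd group.ord G b"
proof -
  interpret comm_group G by fact
  obtain c where "c \<in> carrier G" "ord c = gcd (ord a) (ord b)"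
    using ex_ord_dvd_lcm[OF fin ab, of "gcd (ord a) (ord b)"] by (auto intro: dvd_trans)
  then have "ord (rep_of_ord G R (gcd (ord a) (ord b))) = gcd (ord a) (ord b)"
    by (rule rep_of_ord(3)[OF R])
  moreover have "ord (rep_of_ord G R (ord a)) = ord a"
    using ab(1) refl by (rule rep_of_ord(3)[OF R])
  ultimately have "rep_of_ord G R (gcd (ord a) (ord b)) = rep_of_ord G R (ord a)
      \<longleftrightarrow> gcd (ord a) (ord b) = ord a"
    by metis
  also have "\<dots> \<longleftrightarrow> ord a dvd ord b"
    by (rule gcd_nat.absorb_iff1[symmetric])
  finally show ?thesis
    using ab by (simp only: order_e_lattice_simps[OF R])
qed

lemma e_iso_imp_ord_dvd_iff:
  assumes G: "comm_group G" "finite (carrier G)" "ord_reps G R"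
    and G': "comm_group G'" "finite (carrier G')" "ord_reps G' R'"
    and f: "f \<in> e_iso (order_e_lattice G R) (order_e_lattice G' R')"
    and ab: "a \<in> carrier G" "b \<in> carrier G"
  shows "group.ord G' (f a) dvd group.ord G' (f b) \<longleftrightarrow> group.ord G a dvd group.ord G b"
proof -
  let ?L = "order_e_lattice G R" and ?L' = "order_e_lattice G' R'"
  interpret L: canonical_e_lattice ?L
    using G by (rule canonical_e_lattice_order_e_lattice)
  note carr = order_e_lattice_simps(1)[OF G(3)] order_e_lattice_simps(1)[OF G'(3)]
  have bij: "bij_betw f (carrier G) (carrier G')"
    and hom: "f (eps ?L a) = eps ?L' (f a)" "f (emeet ?L a b) = emeet ?L' (f a) (f b)"
    using f ab by (simp_all add: e_iso_def e_hom_def carr)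
  have fab: "f a \<in> carrier G'" "f b \<in> carrier G'"
    using bij ab by (auto simp: bij_betw_def)
  have "group.ord G' (f a) dvd group.ord G' (f b) \<longleftrightarrow> f (emeet ?L a b) = f (eps ?L a)"
    using emeet_eq_eps_iff_ord_dvd[OF G' fab] hom by simp
  also have "\<dots> \<longleftrightarrow> emeet ?L a b = eps ?L a"
    using bij L.meet_closed[of a b] L.eps_closed[of a] ab
    by (intro inj_on_eq_iff) (auto simp: bij_betw_def carr)
  also have "\<dots> \<longleftrightarrow> group.ord G a dvd group.ord G b"
    by (rule emeet_eq_eps_iff_ord_dvd[OF G ab])
  finally show ?thesis .
qed

text \<open>The lattice isomorphism is the group isomorphism \<open>f\<close> followed by a permutation \<open>\<pi>\<close> of \<open>G'\<close> that
  preserves orders. On the elements of order \<open>d\<close>, \<open>\<pi>\<close> swaps the image under \<open>f\<close> of the representative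
  chosen in \<open>G\<close> with the representative chosen in \<open>G'\<close>.\<close>

lemma e_isomorphic_order_e_lattice_if_iso:
  assumes G: "comm_group G" "finite (carrier G)" "ord_reps G R"
    and G': "comm_group G'" "ord_reps G' R'"
    and "G \<cong> G'"
  shows "order_e_lattice G R \<cong>\<^sub>\<epsilon> order_e_lattice G' R'"
proof -
  interpret G: comm_group G by fact
  interpret G': comm_group G' by fact
  obtain f where f: "f \<in> iso G G'"
    using \<open>G \<cong> G'\<close> by (auto simp: is_iso_def)
  then have bij: "bij_betw f (carrier G) (carrier G')"
    by (simp add: iso_def)
  have f_ord: "f a \<in> carrier G'" "G'.ord (f a) = G.ord a" if "a \<in> carrier G" for a
    using bij that iso_ord[OF G.is_group G'.is_group f that] by (auto simp: bij_betw_def)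
  let ?rep = "rep_of_ord G R" and ?rep' = "rep_of_ord G' R'"
  define \<pi> where "\<pi> y = Transposition.transpose (f (?rep (G'.ord y))) (?rep' (G'.ord y)) y" for y
  have swapped: "f (?rep (G'.ord y)) \<in> carrier G'" "G'.ord (f (?rep (G'.ord y))) = G'.ord y"
    "?rep' (G'.ord y) \<in> carrier G'" "G'.ord (?rep' (G'.ord y)) = G'.ord y"
    if y: "y \<in> carrier G'" for y
  proof -
    obtain a where a: "a \<in> carrier G" "y = f a"
      using bij y by (auto simp: bij_betw_def)
    then have "?rep (G'.ord y) \<in> carrier G" "G.ord (?rep (G'.ord y)) = G'.ord y"
      using rep_of_ord(2,3)[OF G(3) a(1)] f_ord by simp_all
    then show "f (?rep (G'.ord y)) \<in> carrier G'" "G'.ord (f (?rep (G'.ord y))) = G'.ord y"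
      using f_ord by simp_all
    show "?rep' (G'.ord y) \<in> carrier G'" "G'.ord (?rep' (G'.ord y)) = G'.ord y"
      using rep_of_ord(2,3)[OF G'(2) y] by simp_all
  qed
  have \<pi>: "\<pi> y \<in> carrier G'" "G'.ord (\<pi> y) = G'.ord y" if "y \<in> carrier G'" for y
    using swapped[OF that] that by (auto simp: \<pi>_def Transposition.transpose_def)
  have invol: "\<pi> (\<pi> y) = y" if "y \<in> carrier G'" for y
    using \<pi>(2)[OF that] by (simp add: \<pi>_def)
  have "bij_betw \<pi> (carrier G') (carrier G')"
    by (rule bij_betw_byWitness[where f' = \<pi>]) (auto simp: invol \<pi>)
  define g where "g = \<pi> \<circ> f"
  have g_bij: "bij_betw g (carrier G) (carrier G')"
    unfolding g_def using bij \<open>bij_betw \<pi> _ _\<close> by (rule bij_betw_trans)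
  have g: "g a \<in> carrier G'" "G'.ord (g a) = G.ord a" if "a \<in> carrier G" for a
    using f_ord[OF that] \<pi> by (simp_all add: g_def)
  have g_rep: "g (?rep d) = ?rep' d" if "c \<in> carrier G" "G.ord c = d" for c d
    using rep_of_ord(2,3)[OF G(3) that] f_ord(2) by (simp add: g_def \<pi>_def)
  have g_rep_gcd: "g (?rep (gcd (G.ord a) (G.ord b))) = ?rep' (gcd (G.ord a) (G.ord b))"
    and g_rep_lcm: "g (?rep (lcm (G.ord a) (G.ord b))) = ?rep' (lcm (G.ord a) (G.ord b))"
    if ab: "a \<in> carrier G" "b \<in> carrier G" for a b
  proof -
    have "gcd (G.ord a) (G.ord b) dvd lcm (G.ord a) (G.ord b)"
      by (auto intro: dvd_trans)
    then show "g (?rep (gcd (G.ord a) (G.ord b))) = ?rep' (gcd (G.ord a) (G.ord b))"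
      using G.ex_ord_dvd_lcm[OF G(2) ab] g_rep by blast
    show "g (?rep (lcm (G.ord a) (G.ord b))) = ?rep' (lcm (G.ord a) (G.ord b))"
      using G.ex_ord_dvd_lcm[OF G(2) ab dvd_refl] g_rep by blast
  qed
  have "g \<in> e_iso (order_e_lattice G R) (order_e_lattice G' R')"
    using g_bij g g_rep[OF _ refl] g_rep_gcd g_rep_lcm
    by (simp add: e_iso_def e_hom_def order_e_lattice_simps[OF G(3)] order_e_lattice_simps[OF G'(2)])
  then show ?thesis
    by (auto simp: e_isomorphic_def)
qed

theorem theorem5:
  fixes G :: "('a, 'm) monoid_scheme" and G' :: "('b, 'n) monoid_scheme"
    and R :: "'a set" and R' :: "'b set"
  assumes "comm_group G" and "finite (carrier G)"
    and "comm_group G'" and "finite (carrier G')"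
    and "ord_reps G R" and "ord_reps G' R'"
  shows "G \<cong> G' \<longleftrightarrow> order_e_lattice G R \<cong>\<^sub>\<epsilon> order_e_lattice G' R'"
proof
  assume "G \<cong> G'"
  then show "order_e_lattice G R \<cong>\<^sub>\<epsilon> order_e_lattice G' R'"
    by (rule e_isomorphic_order_e_lattice_if_iso[OF assms(1,2,5,3,6)])
next
  assume "order_e_lattice G R \<cong>\<^sub>\<epsilon> order_e_lattice G' R'"
  then obtain f where f: "f \<in> e_iso (order_e_lattice G R) (order_e_lattice G' R')"
    by (auto simp: e_isomorphic_def)
  interpret G: comm_group G by fact
  interpret G': comm_group G' by fact
  have bij: "bij_betw f (carrier G) (carrier G')"
    using f by (simp add: e_iso_def order_e_lattice_simps(1)[OF assms(5)]
        order_e_lattice_simps(1)[OF assms(6)])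
  have ord: "G'.ord (f a) = G.ord a" if "a \<in> carrier G" for a
    using ord_eq_if_ord_dvd_iff[OF assms(1-4) bij
        e_iso_imp_ord_dvd_iff[OF assms(1,2,5,3,4,6) f] that] by blast
  have "card (torsion G d) = card (torsion G' d)" for d
  proof -
    have "torsion G d = {a \<in> carrier G. G'.ord (f a) dvd d}"
      using ord by (auto simp: G.torsion_eq_ord_dvd)
    then have "bij_betw f (torsion G d) (torsion G' d)"
      using bij_betw_Collect[OF bij refl, of "\<lambda>y. G'.ord y dvd d"]
      by (simp add: G'.torsion_eq_ord_dvd)
    then show ?thesis
      by (rule bij_betw_same_card)
  qed
  then show "G \<cong> G'"
    by (rule comm_group_iso_if_card_torsion_eq[OF assms(1-4)])
qed

end
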